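(* Let $S\subset\mathbb{R}^n$ be a closed set and let $r>0$ be such that the closed set $\operatorname{cl}(\operatorname{int} S)$ satisfies the exterior $r$-sphere condition. Then $(\operatorname{int} S)^c$ is the union of closed $\frac{r}{2}$-balls. If in addition $S$ is regular closed, i.e. $S=\operatorname{cl}(\operatorname{int} S)$, then $S^c$ is the union of closed $r'$-balls for every $r'$ with $0<r'<\frac{r}{2}$.
   Context: $\mathbb{R}^n$ carries the standard inner product $\langle\cdot,\cdot\rangle$ and the Euclidean norm $\|\cdot\|$. $B(y;\rho)$ and $\bar B(y;\rho)$ denote the open and closed balls of radius $\rho>0$ centered at $y$; $A^c$ denotes the complement of $A$ in $\mathbb{R}^n$; $\operatorname{int}$, $\operatorname{cl}$, $\operatorname{bdry}$ denote interior, closure, boundary. For a closed set $A\subset\mathbb{R}^n$ and $x\in A$, the proximal normal cone $N^P_A(x)$ is the set of all $\zeta\in\mathbb{R}^n$ for which there exists $\sigma\ge 0$ with $\langle \zeta,s-x\rangle\le\sigma\|s-x\|^2$ for all $s\in A$. A nonzero $\zeta\in N^P_A(x)$ is said to be realized by an $r$-sphere ($r>0$) if $B\left(x+r\frac{\zeta}{\|\zeta\|};r\right)\cap A=\emptyset$ (equivalently, $\left\langle \frac{\zeta}{\|\zeta\|},s-x\right\rangle\le\frac{1}{2r}\|s-x\|^2$ for all $s\in A$). A closed set $A$ satisfies the exterior $r$-sphere condition if for every $x\in\operatorname{bdry}A$ there exists $0\neq\zeta\in N^P_A(x)$ that is realized by an $r$-sphere. A set $E\subset\mathbb{R}^n$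 is the union of closed $\rho$-balls ($\rho>0$) if for every $x\in E$ there exists $y\in\mathbb{R}^n$ such that $x\in\bar B(y;\rho)\subset E$. *)

theory Defs
  imports "HOL-Analysis.Analysis"
begin

(* The paper uses the proximal normal cone, realization by an r-sphere and the
   exterior r-sphere condition only for closed A, and the first two only at
   points x of A.  The definitions do not repeat these requirements; for closed A
   every x in frontier A lies in A. *)

definition proximal_normal_cone :: "'a::euclidean_space set \<Rightarrow> 'a \<Rightarrow> 'a set" where
  "proximal_normal_cone A x =
     {\<zeta>. \<exists>\<sigma>\<ge>0. \<forall>s\<in>A. \<zeta> \<bullet> (s - x) \<le> \<sigma> * (norm (s - x))\<^sup>2}"

definition realized_by_sphere :: "real \<Rightarrow> 'a::euclidean_space set \<Rightarrow> 'a \<Rightarrow> 'a \<Rightarrow> bool" where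
  "realized_by_sphere r A x \<zeta> \<longleftrightarrow> ball (x + r *\<^sub>R (\<zeta> /\<^sub>R norm \<zeta>)) r \<inter> A = {}"

definition exterior_sphere_condition :: "real \<Rightarrow> 'a::euclidean_space set \<Rightarrow> bool" where
  "exterior_sphere_condition r A \<longleftrightarrow>
     (\<forall>x\<in>frontier A. \<exists>\<zeta>\<in>proximal_normal_cone A x. \<zeta> \<noteq> 0 \<and> realized_by_sphere r A x \<zeta>)"

definition union_of_closed_balls :: "real \<Rightarrow> 'a::euclidean_space set \<Rightarrow> bool" where
  "union_of_closed_balls \<rho> E \<longleftrightarrow> (\<forall>x\<in>E. \<exists>y. x \<in> cball y \<rho> \<and> cball y \<rho> \<subseteq> E)"

end

theory Submission
  imports Defs
begin

text \<open>
  Put \<open>A = closure (interior S)\<close>, let \<open>x \<notin> A\<close>, and let \<open>p\<close> be a point of \<open>A\<close> nearest to \<open>x\<close>, at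
  distance \<open>d\<close>. If \<open>d \<ge> r / 2\<close>, take the ball about \<open>x\<close>; so let \<open>d < r / 2\<close>. As \<open>A\<close> is the
  closure of its interior, \<open>p\<close> is a limit of boundary points at which a segment in direction
  \<open>x - p\<close> leaves \<open>interior A\<close>; exterior spheres at these points converge to an
  \<open>r\<close>-sphere at \<open>p\<close> whose unit normal \<open>u\<close> satisfies \<open>u \<bullet> (x - p) \<ge> 0\<close>. If the ball about
  \<open>p + r u\<close> does not already contain \<open>x\<close>, choose \<open>m = p + a r u\<close> with \<open>0 \<le> a \<le> 1\<close> and
  \<open>dist x m = r\<close>. Every \<open>s \<in> A\<close> satisfies \<open>dist s x \<ge> d\<close> and \<open>dist s m \<ge> a r\<close>, while
  \<open>r\<^sup>2 = (dist x m)\<^sup>2 \<le> d\<^sup>2 + (a r)\<^sup>2\<close>, so the angle of the triangle \<open>x s m\<close> at \<open>s\<close> is not obtuse: \<open>s\<close> lies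
  outside the open ball with diameter \<open>x m\<close>, whose radius is \<open>r / 2\<close>.
\<close>

section \<open>Exterior spheres at nearest points\<close>

lemma exterior_sphere_conditionE:
  fixes A :: "'a::euclidean_space set"
  assumes "exterior_sphere_condition r A" "x \<in> frontier A"
  obtains u where "norm u = 1" "ball (x + r *\<^sub>R u) r \<inter> A = {}"
proof -
  obtain z where "z \<noteq> 0" "realized_by_sphere r A x z"
    using assms unfolding exterior_sphere_condition_def by blast
  then show thesis
    using that[of "z /\<^sub>R norm z"] by (simp add: realized_by_sphere_def)
qed

text \<open>The exit time is the minimum of the compact set of times spent outside the open set
  \<open>interior A\<close>; the exit point is a limit of earlier points of the segment, all of them
  interior.\<close>

lemma segment_exit_point:
  fixes q d :: "'a::real_normed_vector"
  assumes "q \<in> interior A" "q + T *\<^sub>R d \<notin> interior A" "0 \<le> T"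
  obtains t where "0 < t" "t \<le> T" "q + t *\<^sub>R d \<in> frontier A"
    "\<And>s. 0 \<le> s \<Longrightarrow> s < t \<Longrightarrow> q + s *\<^sub>R d \<in> interior A"
proof -
  define f where "f = (\<lambda>t::real. q + t *\<^sub>R d)"
  define K where "K = {0..T} \<inter> f -` (- interior A)"
  have cont: "continuous_on UNIV f"
    unfolding f_def by (intro continuous_intros)
  have "closed (f -` (- interior A))"
    by (intro closed_vimage) (use cont in auto)
  then have "compact K"
    unfolding K_def by (intro compact_Int_closed) auto
  moreover have "T \<in> K"
    using assms by (simp add: K_def f_def)
  ultimately obtain t where t: "t \<in> K" "\<And>s. s \<in> K \<Longrightarrow> t \<le> s"
    using compact_attains_inf[of K] by auto
  have "t \<noteq> 0"
    using t(1) assms(1) by (auto simp: K_def f_def)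
  then have t_pos: "0 < t" "t \<le> T"
    using t(1) by (auto simp: K_def)
  have inside: "f s \<in> interior A" if "0 \<le> s" "s < t" for s
    using t(2)[of s] that t_pos by (auto simp: K_def)
  have "t \<in> closure {0..<t}"
    using t_pos by simp
  then have "f t \<in> f ` closure {0..<t}"
    by blast
  also have "\<dots> \<subseteq> closure A"
  proof (rule image_closure_subset)
    show "continuous_on (closure {0..<t}) f"
      using cont continuous_on_subset by blast
    show "f ` {0..<t} \<subseteq> closure A"
      using inside interior_subset[of A] closure_subset[of A] by fastforce
  qed simp
  finally have "f t \<in> frontier A"
    using t(1) by (simp add: frontier_def K_def)
  then show thesis
    using that t_pos inside by (auto simp: f_def)
qed

text \<open>The points \<open>b - s *\<^sub>R d\<close> avoid the ball, so
  \<open>s *\<^sub>R d + r *\<^sub>R u\<close> has norm at least \<open>r\<close>. Square, cancel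
  \<open>r\<^sup>2\<close>, divide by \<open>s\<close> and let \<open>s\<close> tend to 0 from the
  right.\<close>

lemma inner_nonneg_if_empty_ball:
  fixes b d u :: "'a::real_inner"
  assumes "norm u = 1" "0 < r" "0 < t"
    and empty: "ball (b + r *\<^sub>R u) r \<inter> A = {}"
    and mem: "\<And>s. 0 < s \<Longrightarrow> s \<le> t \<Longrightarrow> b - s *\<^sub>R d \<in> A"
  shows "0 \<le> u \<bullet> d"
proof -
  have "0 \<le> s * (d \<bullet> d) + 2 * r * (u \<bullet> d)" if s: "0 < s" "s \<le> t" for s
  proof -
    have "b - s *\<^sub>R d \<notin> ball (b + r *\<^sub>R u) r"
      using empty mem[OF s] by blast
    moreover have "(b + r *\<^sub>R u) - (b - s *\<^sub>R d) = s *\<^sub>R d + r *\<^sub>R u"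
      by simp
    ultimately have "r \<le> norm (s *\<^sub>R d + r *\<^sub>R u)"
      by (simp only: mem_ball dist_norm not_less)
    then have "r\<^sup>2 \<le> (norm (s *\<^sub>R d + r *\<^sub>R u))\<^sup>2"
      using \<open>0 < r\<close> by (intro power_mono) auto
    also have "\<dots> = s * (s * (d \<bullet> d) + 2 * r * (u \<bullet> d)) + r\<^sup>2"
      using \<open>norm u = 1\<close>
      by (simp only: power2_norm_eq_inner inner_add_left inner_add_right norm_eq_1)
        (simp add: inner_commute power2_eq_square algebra_simps)
    finally show ?thesis
      using s by (simp add: zero_le_mult_iff)
  qed
  then have "\<forall>\<^sub>F s in at_right 0. 0 \<le> s * (d \<bullet> d) + 2 * r * (u \<bullet> d)"
    unfolding eventually_at_right_field using \<open>0 < t\<close> by (intro exI[of _ t]) auto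
  moreover have "((\<lambda>s. s * (d \<bullet> d) + 2 * r * (u \<bullet> d)) \<longlongrightarrow> 0 * (d \<bullet> d) + 2 * r * (u \<bullet> d)) (at_right 0)"
    by (intro tendsto_intros)
  ultimately have "0 \<le> 0 * (d \<bullet> d) + 2 * r * (u \<bullet> d)"
    by (intro tendsto_lowerbound) auto
  then show ?thesis
    using \<open>0 < r\<close> by (simp add: zero_le_mult_iff)
qed

text \<open>The condition at \<open>p\<close> itself would leave the sign of
  \<open>u \<bullet> (x - p)\<close> open. An exit point has a segment of \<open>A\<close> behind it
  in direction \<open>p - x\<close>, which settles the sign.\<close>

lemma exterior_sphere_near_nearest_point:
  fixes A :: "'a::euclidean_space set"
  assumes "exterior_sphere_condition r A" "0 < r"
    and "p \<in> closure (interior A)" "x \<noteq> p" "ball x (dist x p) \<inter> A = {}" "0 < e"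
  obtains b u where "dist b p < e" "norm u = 1" "ball (b + r *\<^sub>R u) r \<inter> A = {}" "0 \<le> u \<bullet> (x - p)"
proof -
  define d where "d = dist x p"
  have "0 < d"
    using assms by (simp add: d_def)
  \<comment> \<open>Half of \<open>e\<close> pays for \<open>dist q p\<close>, the other half for
    the way from \<open>q\<close> to the exit point; the bound \<open>d\<close> keeps
    \<open>1 - \<delta> / d\<close> nonnegative.\<close>
  define \<delta> where "\<delta> = min (e / 2) d"
  have \<delta>: "0 < \<delta>" "\<delta> \<le> d" "2 * \<delta> \<le> e"
    using \<open>0 < d\<close> \<open>0 < e\<close> by (auto simp: \<delta>_def)
  obtain q where q: "q \<in> interior A" "dist q p < \<delta>"
    using assms(3) \<delta>(1) closure_approachable by blast
  have norm_d: "norm (x - p) = d"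
    by (simp add: d_def dist_norm)
  \<comment> \<open>Moving by \<open>\<delta>\<close> outweighs the error
    \<open>dist q p < \<delta>\<close>, so the segment ends in the ball about \<open>x\<close> that
    misses \<open>A\<close>.\<close>
  have "q + (\<delta> / d) *\<^sub>R (x - p) \<in> ball x (dist x p)"
  proof -
    have "x - (q + (\<delta> / d) *\<^sub>R (x - p)) = (p - q) + (1 - \<delta> / d) *\<^sub>R (x - p)"
      by (simp add: algebra_simps)
    also have "norm \<dots> \<le> norm (p - q) + \<bar>1 - \<delta> / d\<bar> * d"
      by (metis norm_scaleR norm_triangle_ineq norm_d)
    also have "\<bar>1 - \<delta> / d\<bar> * d = d - \<delta>"
      using \<delta> \<open>0 < d\<close> by (simp add: abs_if field_simps)
    also have "norm (p - q) + (d - \<delta>) < d"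
      using q(2) by (simp add: dist_norm norm_minus_commute)
    finally show ?thesis
      by (simp add: dist_norm d_def)
  qed
  then have "q + (\<delta> / d) *\<^sub>R (x - p) \<notin> interior A"
    using assms(5) interior_subset by blast
  then obtain t where t: "0 < t" "t \<le> \<delta> / d" "q + t *\<^sub>R (x - p) \<in> frontier A"
      "\<And>s. 0 \<le> s \<Longrightarrow> s < t \<Longrightarrow> q + s *\<^sub>R (x - p) \<in> interior A"
    using segment_exit_point[OF q(1)] \<delta>(1) \<open>0 < d\<close> by (metis divide_nonneg_nonneg less_imp_le)
  obtain u where u: "norm u = 1" "ball (q + t *\<^sub>R (x - p) + r *\<^sub>R u) r \<inter> A = {}"
    using exterior_sphere_conditionE[OF assms(1) t(3)] .
  show thesis
  proof
    have "dist (q + t *\<^sub>R (x - p)) p \<le> dist q p + t * d"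
      using norm_triangle_ineq[of "q - p" "t *\<^sub>R (x - p)"] t(1) norm_d
      by (simp add: dist_norm add_diff_eq diff_add_eq)
    also have "t * d \<le> \<delta>"
      using t(2) \<open>0 < d\<close> by (simp add: field_simps)
    finally show "dist (q + t *\<^sub>R (x - p)) p < e"
      using q(2) \<delta>(3) by linarith
    show "0 \<le> u \<bullet> (x - p)"
    proof (rule inner_nonneg_if_empty_ball[OF u(1) \<open>0 < r\<close> t(1) u(2)])
      fix s :: real
      assume "0 < s" "s \<le> t"
      then show "q + t *\<^sub>R (x - p) - s *\<^sub>R (x - p) \<in> A"
        using t(4)[of "t - s"] interior_subset by (auto simp: algebra_simps)
    qed
  qed (use u in auto)
qed

text \<open>Compactness of the unit sphere gives a convergent subsequence of normals; the empty
  ball, read as \<open>r \<le> dist\<close> to each point of \<open>A\<close>, and the sign are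
  closed conditions.\<close>

lemma exterior_sphere_at_nearest_point:
  fixes A :: "'a::euclidean_space set"
  assumes "exterior_sphere_condition r A" "0 < r"
    and "p \<in> closure (interior A)" "x \<noteq> p" "ball x (dist x p) \<inter> A = {}"
  obtains u where "norm u = 1" "ball (p + r *\<^sub>R u) r \<inter> A = {}" "0 \<le> u \<bullet> (x - p)"
proof -
  have "\<exists>b u. dist b p < inverse (real (Suc n)) \<and> norm u = 1 \<and>
      ball (b + r *\<^sub>R u) r \<inter> A = {} \<and> 0 \<le> u \<bullet> (x - p)" for n
    by (rule exterior_sphere_near_nearest_point[OF assms, of "inverse (real (Suc n))"]) auto
  then obtain b u where bu: "\<And>n. dist (b n) p < inverse (real (Suc n))" "\<And>n. norm (u n) = 1"
      "\<And>n. ball (b n + r *\<^sub>R u n) r \<inter> A = {}" "\<And>n. 0 \<le> u n \<bullet> (x - p)"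
    by metis
  have b: "b \<longlonglongrightarrow> p"
    using tendsto_dist_iff[of b p sequentially]
      tendsto_sandwich[of "\<lambda>_. 0" "\<lambda>n. dist (b n) p" sequentially "\<lambda>n. inverse (real (Suc n))" 0]
      LIMSEQ_inverse_real_of_nat bu(1)
    by (simp add: less_imp_le)
  have "\<forall>n. u n \<in> sphere 0 1"
    using bu(2) by simp
  then obtain w k where w: "norm w = 1" "strict_mono k" "(u \<circ> k) \<longlonglongrightarrow> w"
    using compact_sphere[of "0::'a" 1] unfolding compact_def by (metis mem_sphere_0)
  have bk: "(\<lambda>n. b (k n)) \<longlonglongrightarrow> p"
    using LIMSEQ_subseq_LIMSEQ[OF b w(2)] by (simp add: o_def)
  have uk: "(\<lambda>n. u (k n)) \<longlonglongrightarrow> w"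
    using w(3) by (simp add: o_def)
  show thesis
  proof
    show "ball (p + r *\<^sub>R w) r \<inter> A = {}"
    proof -
      have "r \<le> dist (p + r *\<^sub>R w) s" if "s \<in> A" for s
      proof (rule tendsto_lowerbound)
        show "(\<lambda>n. dist (b (k n) + r *\<^sub>R u (k n)) s) \<longlonglongrightarrow> dist (p + r *\<^sub>R w) s"
          by (intro tendsto_intros bk uk)
        show "\<forall>\<^sub>F n in sequentially. r \<le> dist (b (k n) + r *\<^sub>R u (k n)) s"
          using bu(3) that by (intro always_eventually) (fastforce simp: not_less[symmetric])
      qed simp
      then show ?thesis
        by fastforce
    qed
    show "0 \<le> w \<bullet> (x - p)"
    proof (rule tendsto_lowerbound)
      show "(\<lambda>n. u (k n) \<bullet> (x - p)) \<longlonglongrightarrow> w \<bullet> (x - p)"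
        by (intro tendsto_intros uk)
    qed (use bu(4) in auto)
  qed (use w in auto)
qed

section \<open>Balls of half the radius and smaller\<close>

lemma dist_midpoint_power2:
  fixes s x m :: "'a::real_inner"
  shows "4 * (dist (midpoint x m) s)\<^sup>2 = 2 * (dist s x)\<^sup>2 + 2 * (dist s m)\<^sup>2 - (dist x m)\<^sup>2"
proof -
  \<comment> \<open>This sets up the parallelogram law: the vector is the sum of
    \<open>x - s\<close> and \<open>m - s\<close>, whose difference is \<open>x - m\<close>.\<close>
  have "2 * dist (midpoint x m) s = norm ((x + m) - 2 *\<^sub>R s)"
  proof -
    have "(x + m) - 2 *\<^sub>R s = 2 *\<^sub>R (midpoint x m - s)"
      by (simp add: midpoint_def algebra_simps)
    then show ?thesis
      by (simp add: dist_norm)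
  qed
  then have "4 * (dist (midpoint x m) s)\<^sup>2 = (norm ((x + m) - 2 *\<^sub>R s))\<^sup>2"
    by (metis power_mult_distrib power2_eq_square mult_2 numeral_Bit0)
  then show ?thesis
    by (simp add: dist_norm power2_norm_eq_inner inner_diff_left inner_diff_right inner_add_left
        inner_add_right inner_commute algebra_simps)
qed

lemma half_radius_ball:
  fixes A :: "'a::euclidean_space set"
  assumes "0 < r" "norm u = 1" "ball (p + r *\<^sub>R u) r \<inter> A = {}" "0 \<le> u \<bullet> (x - p)"
    and "ball x (dist x p) \<inter> A = {}"
  obtains c where "x \<in> cball c (r / 2)" "ball c (r / 2) \<inter> A = {}"
proof (cases "r / 2 \<le> dist x p")
  case True
  then show thesis
    using that[of x] assms(1,5) by (force simp: subset_eq)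
next
  case near: False
  define q where "q = p + r *\<^sub>R u"
  have far: "dist x p \<le> dist s x" "r \<le> dist s q" if "s \<in> A" for s
    using assms(3,5) that by (force simp: q_def dist_commute)+
  show thesis
  proof (cases "dist x q \<le> r")
    case True
    \<comment> \<open>The midpoint is within \<open>r / 2\<close> of \<open>q\<close>, so its open
      ball of that radius lies in the empty ball about \<open>q\<close>.\<close>
    show thesis
    proof (rule that[of "midpoint x q"])
      show "x \<in> cball (midpoint x q) (r / 2)"
        using True by (simp add: dist_midpoint dist_commute)
      have "r / 2 \<le> dist (midpoint x q) s" if "s \<in> A" for s
        using far(2)[OF that] dist_triangle[of s q "midpoint x q"] True dist_midpoint(4)[of x q]
        by (simp add: dist_commute)
      then show "ball (midpoint x q) (r / 2) \<inter> A = {}"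
        by fastforce
    qed
  next
    case False
    \<comment> \<open>The distance is below \<open>r / 2\<close> at \<open>a = 0\<close> and above
      \<open>r\<close> at \<open>a = 1\<close>.\<close>
    have "\<exists>a\<ge>0. a \<le> 1 \<and> dist x (p + (a * r) *\<^sub>R u) = r"
      using near False assms(1)
      by (intro IVT') (auto simp: q_def intro!: continuous_intros)
    then obtain a where a: "0 \<le> a" "a \<le> 1" "dist x (p + (a * r) *\<^sub>R u) = r"
      by blast
    define m where "m = p + (a * r) *\<^sub>R u"
    have "r\<^sup>2 = (norm ((x - p) - (a * r) *\<^sub>R u))\<^sup>2"
      using a(3) by (simp add: dist_norm algebra_simps)
    also have "\<dots> = (dist x p)\<^sup>2 + (a * r)\<^sup>2 - 2 * (a * r) * (u \<bullet> (x - p))"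
      using assms(2) power2_norm_eq_inner[of u]
      by (simp only: dist_norm power2_norm_eq_inner inner_diff_left inner_diff_right)
        (simp add: inner_commute power2_eq_square algebra_simps)
    also have "\<dots> \<le> (dist x p)\<^sup>2 + (a * r)\<^sup>2"
      using a(1) assms(1,4) by simp
    finally have r_le: "r\<^sup>2 \<le> (dist x p)\<^sup>2 + (a * r)\<^sup>2" .
    have "r / 2 \<le> dist (midpoint x m) s" if "s \<in> A" for s
    proof -
      \<comment> \<open>As \<open>m\<close> is at distance \<open>(1 - a) * r\<close> from
        \<open>q\<close>, the ball of radius \<open>a * r\<close> about \<open>m\<close> lies in the
        empty ball about \<open>q\<close>.\<close>
      have "dist m q = norm (((a - 1) * r) *\<^sub>R u)"
        by (simp add: m_def q_def dist_norm algebra_simps)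
      also have "\<dots> = (1 - a) * r"
        using a(2) assms(1,2) by (simp add: abs_mult)
      finally have "a * r \<le> dist s m"
        using far(2)[OF that] dist_triangle[of s q m] by (simp add: algebra_simps)
      then have "(a * r)\<^sup>2 \<le> (dist s m)\<^sup>2"
        using a(1) assms(1) by (intro power_mono) auto
      moreover have "(dist x p)\<^sup>2 \<le> (dist s x)\<^sup>2"
        using far(1)[OF that] by (intro power_mono) auto
      moreover have "(dist x m)\<^sup>2 = r\<^sup>2"
        using a(3) by (simp add: m_def)
      \<comment> \<open>The median formula gives at least
        \<open>2 * r\<^sup>2 - r\<^sup>2\<close>.\<close>
      ultimately have "r\<^sup>2 \<le> 4 * (dist (midpoint x m) s)\<^sup>2"
        using r_le dist_midpoint_power2[of x m s] by linarith
      then have "(r / 2)\<^sup>2 \<le> (dist (midpoint x m) s)\<^sup>2"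
        by (simp add: power_divide)
      then show ?thesis
        by (rule power2_le_imp_le) simp
    qed
    then have "ball (midpoint x m) (r / 2) \<inter> A = {}"
      by fastforce
    moreover have "x \<in> cball (midpoint x m) (r / 2)"
      using a(3) by (simp add: m_def dist_midpoint dist_commute)
    ultimately show thesis
      using that by blast
  qed
qed

lemma exterior_sphere_half_radius_ball:
  fixes A :: "'a::euclidean_space set"
  assumes "A = closure (interior A)" "0 < r" "exterior_sphere_condition r A" "x \<notin> interior A"
  obtains c where "x \<in> cball c (r / 2)" "ball c (r / 2) \<inter> A = {}"
proof -
  have "closed A"
    using assms(1) by (metis closed_closure)
  consider "x \<in> frontier A" | "A = {}" | "x \<notin> A" "A \<noteq> {}"
    using assms(4) closure_subset[of A] by (auto simp: frontier_def)
  then show thesis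
  proof cases
    case 1
    then obtain u where "norm u = 1" "ball (x + r *\<^sub>R u) r \<inter> A = {}"
      using exterior_sphere_conditionE[OF assms(3)] by blast
    \<comment> \<open>With \<open>p = x\<close> the distance and the inner product vanish.\<close>
    then show thesis
      using half_radius_ball[of r u x A x] assms(2) that by auto
  next
    case 2
    then show thesis
      using that[of x] assms(2) by simp
  next
    case 3
    obtain p where p: "p \<in> A" "\<And>y. y \<in> A \<Longrightarrow> dist x p \<le> dist x y"
      using distance_attains_inf[OF \<open>closed A\<close> 3(2), of x] by blast
    have *: "ball x (dist x p) \<inter> A = {}"
      using p(2) by fastforce
    have "p \<in> closure (interior A)" "x \<noteq> p"
      using p(1) 3 assms(1) by auto
    then obtain u where "norm u = 1" "ball (p + r *\<^sub>R u) r \<inter> A = {}" "0 \<le> u \<bullet> (x - p)"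
      using exterior_sphere_at_nearest_point[OF assms(3,2) _ _ *] by blast
    then show thesis
      using half_radius_ball[OF assms(2) _ _ _ *] that by blast
  qed
qed

text \<open>Contract \<open>cball c R\<close> towards \<open>x\<close> by the factor
  \<open>\<rho> / R\<close>. By strict convexity of the ball, every image point other than
  \<open>x\<close> lies in the open ball.\<close>

lemma smaller_cball_touching_at_point:
  fixes x c :: "'a::euclidean_space"
  assumes "x \<in> cball c R" "0 < \<rho>" "\<rho> < R"
  obtains y where "x \<in> cball y \<rho>" "cball y \<rho> \<subseteq> insert x (ball c R)"
proof -
  define t where "t = \<rho> / R"
  have t: "0 < t" "t < 1" "\<rho> = t * R"
    using assms by (auto simp: t_def)
  define y where "y = x + t *\<^sub>R (c - x)"
  have le: "dist x c \<le> R"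
    using assms(1) by (simp add: dist_commute)
  show thesis
  proof
    have "dist y x = t * dist x c"
      using t(1) by (simp add: y_def dist_norm norm_minus_commute)
    then show "x \<in> cball y \<rho>"
      using le t by (simp add: mult_left_mono)
    show "cball y \<rho> \<subseteq> insert x (ball c R)"
    proof
      fix s
      assume s: "s \<in> cball y \<rho>"
      \<comment> \<open>The preimage of \<open>s\<close> under the contraction.\<close>
      define z where "z = c + (1 / t) *\<^sub>R (s - y)"
      have "dist z c = dist s y / t"
        using t(1) by (simp add: z_def dist_norm)
      also have "\<dots> \<le> R"
        using s t by (simp add: dist_commute field_simps)
      finally have z: "z \<in> cball c R"
        by (simp add: dist_commute)
      have s_eq: "s = (1 - t) *\<^sub>R x + t *\<^sub>R z"
        using t(1) by (simp add: z_def y_def algebra_simps)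
      show "s \<in> insert x (ball c R)"
      proof (cases "z = x")
        case True
        then show ?thesis
          using s_eq by (simp add: algebra_simps)
      next
        case False
        then have "s \<in> open_segment x z"
          using s_eq t in_segment(2) by blast
        then have "dist s c < R"
          using dist_decreases_open_segment[of s x z c] z le by (force simp: dist_commute)
        then show ?thesis
          by (simp add: dist_commute)
      qed
    qed
  qed
qed

theorem theorem1p1:
  fixes S :: "(real ^ 'n) set" and r :: real
  assumes "closed S"
    and "r > 0"
    and "exterior_sphere_condition r (closure (interior S))"
  shows "union_of_closed_balls (r / 2) (- interior S) \<and>
    (S = closure (interior S) \<longrightarrow>
      (\<forall>r'. 0 < r' \<and> r' < r / 2 \<longrightarrow> union_of_closed_balls r' (- S)))"
proof -
  define A where "A = closure (interior S)"
  have "A \<subseteq> S"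
    using assms(1) by (simp add: A_def closure_minimal interior_subset)
  \<comment> \<open>Since \<open>A\<close> stays inside the closed set \<open>S\<close>, taking the
    closure adds no interior points.\<close>
  then have int_A: "interior A = interior S"
    by (metis A_def closure_subset interior_maximal interior_mono open_interior subset_antisym)
  have ball: "\<exists>c. x \<in> cball c (r / 2) \<and> ball c (r / 2) \<inter> A = {}" if "x \<notin> interior S" for x
    using exterior_sphere_half_radius_ball[of A r x] assms that int_A by (metis A_def)
  have "union_of_closed_balls (r / 2) (- interior S)"
    unfolding union_of_closed_balls_def
  proof
    fix x
    assume "x \<in> - interior S"
    then obtain c where c: "x \<in> cball c (r / 2)" "ball c (r / 2) \<inter> A = {}"
      using ball by blast
    then have "ball c (r / 2) \<inter> interior S = {}"
      using int_A interior_subset by blast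
    \<comment> \<open>An open set that misses the open ball also misses its closure, so the full
      radius survives.\<close>
    then have "cball c (r / 2) \<inter> interior S = {}"
      using open_Int_closure_eq_empty[of "interior S" "ball c (r / 2)"] assms(2)
      by (simp add: Int_commute)
    then show "\<exists>y. x \<in> cball y (r / 2) \<and> cball y (r / 2) \<subseteq> - interior S"
      using c(1) by blast
  qed
  moreover have "union_of_closed_balls r' (- S)"
    if regular: "S = closure (interior S)" and r': "0 < r'" "r' < r / 2" for r'
    unfolding union_of_closed_balls_def
  proof
    fix x
    assume "x \<in> - S"
    then have "x \<notin> interior S"
      using interior_subset by blast
    moreover have "A = S"
      using regular by (simp add: A_def)
    ultimately obtain c where c: "x \<in> cball c (r / 2)" "ball c (r / 2) \<inter> S = {}"
      using ball by blast
    \<comment> \<open>Only the open ball is known to avoid \<open>S\<close>; the smaller closed ball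
      can leave it only at \<open>x\<close>, which is outside \<open>S\<close>.\<close>
    obtain y where "x \<in> cball y r'" "cball y r' \<subseteq> insert x (ball c (r / 2))"
      using smaller_cball_touching_at_point[OF c(1) r'] .
    then show "\<exists>y. x \<in> cball y r' \<and> cball y r' \<subseteq> - S"
      using c(2) \<open>x \<in> - S\<close> by blast
  qed
  ultimately show ?thesis
    by blast
qed

end
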